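(* For any function $f$ from $\mathbb{N}$ to $\mathbb{R}^{+}$, we have $$E_W(f)=\lim_{n\to+\infty}\frac1n\log(|\mathcal{L}_n(f)|)=h_{\mathrm{top}}(W(f),T).$$
   Context: Here $\mathbb{N}=\{0,1,2,\dots\}$, $\log$ is the natural logarithm, $q\ge 2$ is a fixed integer and $A=\{0,1,\dots,q-1\}$. $A^{\mathbb{N}}$ is the set of infinite words on $A$, and $T$ is the one-sided shift on $A^{\mathbb{N}}$. For $w\in A^{\mathbb{N}}$, $L_n(w)$ is the set of words of length $n$ that are factors of $w$ (i.e. words $v\in A^n$ with $w=v'vv''$ for some finite word $v'$ and infinite word $v''$). The complexity function of $w$ is $p_w(n)=|L_n(w)|$. The entropy of $w$ is $E(w)=\lim_{n\to\infty}\frac1n\log p_w(n)$ (the limit always exists by submultiplicativity of $p_w$). For $f:\mathbb{N}\to\mathbb{R}^+$, $W(f)=\{w\in A^{\mathbb{N}}: p_w(n)\le f(n)\ \text{for all } n\in\mathbb{N}\}$, $\mathcal{L}_n(f)=\bigcup_{w\in W(f)}L_n(w)$, and the word entropy of $f$ is $E_W(f)=\sup_{w\in W(f)}E(w)$. The sequence $\frac1n\log|\mathcal{L}_n(f)|$ converges, because $|\mathcal{L}_{n+n'}(f)|\le|\mathcal{L}_n(f)|\,|\mathcal{L}_{n'}(f)|$, and its limit is the topological entropy $h_{\mathrm{top}}(W(f),T)$ of the subshift $(W(f),T)$. *)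

theory Defs
  imports "HOL-Analysis.Analysis" "HOL-Library.Omega_Words_Fun"
begin

text \<open>Natural logarithm of a cardinality, with \<open>log 0 = -\<infinity>\<close>; the library's real \<open>ln\<close>
  has \<open>ln 0 = 0\<close>, which would give the empty shift the wrong entropy.\<close>

definition elog :: "nat \<Rightarrow> ereal" where
  "elog k = (if k = 0 then -\<infinity> else ereal (ln (real k)))"


section \<open>Topological entropy (Adler, Konheim, McAndrew)\<close>

definition open_cover :: "'a topology \<Rightarrow> 'a set set \<Rightarrow> bool" where
  "open_cover X \<U> \<longleftrightarrow> (\<forall>U\<in>\<U>. openin X U) \<and> \<Union>\<U> = topspace X"

definition subcover_number :: "'a topology \<Rightarrow> 'a set set \<Rightarrow> nat" where
  "subcover_number X \<U> =
     (LEAST k. \<exists>\<V>. \<V> \<subseteq> \<U> \<and> finite \<V> \<and> card \<V> = k \<and> \<Union>\<V> = topspace X)"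

text \<open>The join of \<open>\<U>, T\<^sup>-\<^sup>1 \<U>, \<dots>, T\<^sup>-\<^sup>(\<^sup>n\<^sup>-\<^sup>1\<^sup>) \<U>\<close>: choose one member \<open>c i\<close> of the cover for each time
  \<open>i < n\<close>.\<close>

definition iterated_join ::
    "'a topology \<Rightarrow> ('a \<Rightarrow> 'a) \<Rightarrow> 'a set set \<Rightarrow> nat \<Rightarrow> 'a set set" where
  "iterated_join X T \<U> n =
     {{x \<in> topspace X. \<forall>i<n. (T ^^ i) x \<in> c i} | c. \<forall>i<n. c i \<in> \<U>}"

definition cover_entropy :: "'a topology \<Rightarrow> ('a \<Rightarrow> 'a) \<Rightarrow> 'a set set \<Rightarrow> ereal" where
  "cover_entropy X T \<U> =
     lim (\<lambda>n. ereal (1 / real n) * elog (subcover_number X (iterated_join X T \<U> n)))"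

text \<open>Meant for \<open>X\<close> compact and \<open>T\<close> a continuous self-map of \<open>X\<close>; only the values of \<open>T\<close> on
  \<open>topspace X\<close> matter.\<close>

definition topological_entropy :: "'a topology \<Rightarrow> ('a \<Rightarrow> 'a) \<Rightarrow> ereal" where
  "topological_entropy X T = (SUP \<U>\<in>{\<U>. open_cover X \<U>}. cover_entropy X T \<U>)"


section \<open>Infinite words on the alphabet \<open>{0, \<dots>, q - 1}\<close>\<close>

definition infinite_words :: "nat \<Rightarrow> nat word set" where
  "infinite_words q = {w. range w \<subseteq> {..<q}}"

definition full_shift :: "nat \<Rightarrow> nat word topology" where
  "full_shift q = product_topology (\<lambda>_. discrete_topology {..<q}) UNIV"

definition shift :: "nat word \<Rightarrow> nat word" where
  "shift = suffix 1"

definition factors :: "nat word \<Rightarrow> nat \<Rightarrow> nat list set" where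
  "factors w n = {v. length v = n \<and> (\<exists>v' v''. w = v' \<frown> v \<frown> v'')}"

definition complexity :: "nat word \<Rightarrow> nat \<Rightarrow> nat" where
  "complexity w n = card (factors w n)"

definition entropy :: "nat word \<Rightarrow> real" where
  "entropy w = lim (\<lambda>n. 1 / real n * ln (real (complexity w n)))"

definition words_below :: "nat \<Rightarrow> (nat \<Rightarrow> real) \<Rightarrow> nat word set" where
  "words_below q f = {w \<in> infinite_words q. \<forall>n. real (complexity w n) \<le> f n}"

definition language :: "nat \<Rightarrow> (nat \<Rightarrow> real) \<Rightarrow> nat \<Rightarrow> nat list set" where
  "language q f n = (\<Union>w\<in>words_below q f. factors w n)"

text \<open>The supremum is extended-real-valued, so that it is \<open>-\<infinity>\<close> when \<open>words_below q f\<close> is empty.\<close>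

definition word_entropy :: "nat \<Rightarrow> (nat \<Rightarrow> real) \<Rightarrow> ereal" where
  "word_entropy q f = (SUP w\<in>words_below q f. ereal (entropy w))"

definition subshift :: "nat \<Rightarrow> (nat \<Rightarrow> real) \<Rightarrow> nat word topology" where
  "subshift q f = subtopology (full_shift q) (words_below q f)"

end

theory Submission
  imports Defs
begin

text \<open>
  The set of words whose complexity is bounded by \<open>f\<close> is closed and shift-invariant, and the result
  holds for every such set \<open>X\<close>. Let \<open>L n\<close> be the set of words of length \<open>n\<close> that occur in \<open>X\<close>. Invariance makes these the prefixes of length \<open>n\<close> of the elements of
  \<open>X\<close>, so \<open>card (L n)\<close> is submultiplicative and has a growth rate \<open>h\<close>.

  The entropy of each word of \<open>X\<close> is at most \<open>h\<close>. That these entropies come arbitrarily close to \<open>h\<close>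
  would follow from the variational principle and a generic point of an ergodic measure, but there
  is an elementary proof by counting. Suppose that all entropies are smaller than \<open>c\<close>, and let
  \<open>c < d < h\<close>. Every \<open>x\<close> in \<open>X\<close> has at most \<open>exp (c n)\<close> factors of length \<open>n\<close>, for some \<open>n\<close>
  depending on \<open>x\<close>. Hence its prefix of length \<open>k n\<close>, cut into \<open>k\<close> blocks of length \<open>n\<close>, belongs to a
  set \<open>S n k\<close> of at most \<open>2 ^ (q ^ n) * exp (c n k)\<close> words (\<open>card_block_words\<close>,
  \<open>prefix_mem_block_words\<close>). If \<open>k\<close> is large in terms of \<open>n\<close>, this is at most \<open>exp (d n k) / 2 ^ n\<close>.
  Having a prefix in \<open>S n k\<close> is an open condition, so by compactness finitely many values of \<open>n\<close>
  suffice for all of \<open>X\<close>. Then every word of the language splits into pieces from these finitely many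
  sets, up to a remainder of bounded length, and the factors \<open>1 / 2 ^ n\<close> make a renewal inequality
  (\<open>renewal_bound\<close>) give \<open>card (L n) \<le> C * exp (d n)\<close>. This contradicts \<open>d < h\<close>.

  For the topological entropy, the cover by first letters has joins whose minimal subcovers have
  exactly one element for each word of \<open>L n\<close>. Any open cover is refined by the cylinders of some
  fixed length \<open>B\<close>, so its \<open>n\<close>-th join has a subcover with at most \<open>card (L (n + B))\<close> elements, which
  does not change the growth rate.
\<close>

section \<open>Growth rates of submultiplicative sequences\<close>

text \<open>Fekete's lemma. The limit is the infimum of the quotients: dividing \<open>n\<close> by an index \<open>N\<close> whose
  quotient is nearly minimal leaves a remainder that contributes a bounded amount.\<close>

lemma subadditive_convergent:
  fixes a :: "nat \<Rightarrow> real"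
  assumes sub: "\<And>m n. a (m + n) \<le> a m + a n" and nonneg: "\<And>n. 0 \<le> a n"
  shows "convergent (\<lambda>n. a n / real n)"
proof -
  define L where "L = (INF n\<in>{1..}. a n / real n)"
  have bdd: "bdd_below ((\<lambda>n. a n / real n) ` {1..})"
    by (rule bdd_belowI[of _ 0]) (auto simp: nonneg)
  have lower: "L \<le> a n / real n" if "n \<ge> 1" for n
    unfolding L_def by (rule cINF_lower[OF bdd]) (use that in auto)
  have iter: "a (k * N + r) \<le> real k * a N + a r" for k N r
  proof (induction k)
    case (Suc k)
    have "a (Suc k * N + r) \<le> a N + a (k * N + r)"
      using sub[of N "k * N + r"] by (simp add: algebra_simps)
    with Suc show ?case by (simp add: algebra_simps)
  qed simp
  have "(\<lambda>n. a n / real n) \<longlonglongrightarrow> L"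
  proof (rule order_tendstoI)
    fix y assume "y < L"
    then have "y < a n / real n" if "n \<ge> 1" for n
      using lower[OF that] by linarith
    then show "\<forall>\<^sub>F n in sequentially. y < a n / real n"
      using eventually_ge_at_top[of 1] by (rule eventually_mono[rotated])
  next
    fix y assume "L < y"
    then obtain N where N: "N \<ge> 1" "a N / real N < y"
      unfolding L_def using cINF_less_iff[OF _ bdd] by auto
    define C where "C = (\<Sum>r<N. a r)"
    have C: "a r \<le> C" if "r < N" for r
      unfolding C_def using that nonneg by (intro member_le_sum) auto
    have bound: "a n / real n \<le> a N / real N + C / real n" if "n \<ge> 1" for n
    proof -
      have "a n \<le> real (n div N) * a N + a (n mod N)"
        using iter[of "n div N" N "n mod N"] by simp
      also have "\<dots> \<le> (real n / real N) * a N + C"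
        using N(1) by (intro add_mono mult_right_mono nonneg C of_nat_div_le_of_nat) auto
      finally show ?thesis
        using that by (simp add: field_simps)
    qed
    have "(\<lambda>n. a N / real N + C / real n) \<longlonglongrightarrow> a N / real N + 0"
      by (intro tendsto_intros lim_const_over_n)
    then have "\<forall>\<^sub>F n in sequentially. a N / real N + C / real n < y"
      using N(2) by (intro order_tendstoD) auto
    then show "\<forall>\<^sub>F n in sequentially. a n / real n < y"
      using eventually_ge_at_top[of 1]
      by eventually_elim (use bound in fastforce)
  qed
  then show ?thesis by (rule convergentI)
qed

lemma submultiplicative_growth_convergent:
  fixes a :: "nat \<Rightarrow> nat"
  assumes sub: "\<And>m n. a (m + n) \<le> a m * a n" and pos: "\<And>n. 0 < a n"
  shows "convergent (\<lambda>n. 1 / real n * ln (real (a n)))"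
proof -
  have "convergent (\<lambda>n. ln (real (a n)) / real n)"
  proof (rule subadditive_convergent)
    fix m n
    have "ln (real (a (m + n))) \<le> ln (real (a m) * real (a n))"
      using sub[of m n] pos by (metis ln_mono of_nat_0_less_iff of_nat_mono of_nat_mult)
    also have "\<dots> = ln (real (a m)) + ln (real (a n))"
      using pos by (simp add: ln_mult)
    finally show "ln (real (a (m + n))) \<le> ln (real (a m)) + ln (real (a n))" .
    show "0 \<le> ln (real (a n))"
      using pos[of n] by (simp add: Suc_leI)
  qed
  then show ?thesis by simp
qed

lemma growth_rate_le:
  fixes a :: "nat \<Rightarrow> nat"
  assumes lim: "(\<lambda>n. 1 / real n * ln (real (a n))) \<longlonglongrightarrow> h"
    and bound: "\<And>n. real (a n) \<le> C * exp (d * real n)" and pos: "\<And>n. 0 < a n"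
  shows "h \<le> d"
proof -
  have "0 < C * exp (d * real 0)"
    using bound[of 0] pos[of 0] by (smt (verit) of_nat_0_less_iff)
  then have C: "0 < C" by simp
  have upper: "(\<lambda>n. ln C / real n + d) \<longlonglongrightarrow> 0 + d"
    by (intro tendsto_intros lim_const_over_n)
  have "1 / real n * ln (real (a n)) \<le> ln C / real n + d" if "n \<ge> 1" for n
  proof -
    have "ln (real (a n)) \<le> ln (C * exp (d * real n))"
      using bound[of n] pos[of n] by (intro ln_mono) auto
    also have "\<dots> = ln C + d * real n"
      using C by (simp add: ln_mult)
    finally show ?thesis using that by (simp add: field_simps)
  qed
  then have "h \<le> 0 + d"
    by (intro LIMSEQ_le[OF lim upper]) blast
  then show ?thesis by simp
qed

text \<open>If \<open>a L\<close> is at most a weighted sum of earlier values, then \<open>C exp (d L)\<close> is a supersolution of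
  the recursion as soon as the weights, discounted by \<open>exp (- d)\<close> per unit of length, add up to at
  most 1. This is the Kraft inequality in disguise: applied to the number of words of length \<open>L\<close> that split
  into pieces of several lengths, it gives a bound without counting the ways of splitting.\<close>

lemma renewal_bound:
  fixes a :: "nat \<Rightarrow> real" and s :: "'i \<Rightarrow> real" and len :: "'i \<Rightarrow> nat"
  assumes rec: "\<And>L. B \<le> L \<Longrightarrow> a L \<le> (\<Sum>i\<in>I. s i * a (L - len i))"
    and range: "\<And>i. i \<in> I \<Longrightarrow> 1 \<le> len i \<and> len i \<le> B"
    and s: "\<And>i. i \<in> I \<Longrightarrow> 0 \<le> s i"
    and weight: "(\<Sum>i\<in>I. s i * exp (- (d * real (len i)))) \<le> 1"
    and a: "\<And>n. 0 \<le> a n" and d: "0 \<le> d"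
  shows "\<exists>C. \<forall>L. a L \<le> C * exp (d * real L)"
proof -
  \<comment> \<open>\<open>C\<close> dominates the initial values, to which the recursion does not apply\<close>
  define C where "C = (\<Sum>l<B. a l)"
  have C: "0 \<le> C" unfolding C_def by (intro sum_nonneg a)
  have "a L \<le> C * exp (d * real L)" for L
  proof (induction L rule: less_induct)
    case (less L)
    show ?case
    proof (cases "B \<le> L")
      case False
      then have "a L \<le> C"
        unfolding C_def using a by (intro member_le_sum) auto
      also have "\<dots> \<le> C * exp (d * real L)"
        using C d by (simp add: mult_le_cancel_left1)
      finally show ?thesis .
    next
      case True
      have "a L \<le> (\<Sum>i\<in>I. s i * a (L - len i))" by (rule rec[OF True])
      also have "\<dots> \<le> (\<Sum>i\<in>I. s i * (C * exp (d * real (L - len i))))"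
        using range True s by (intro sum_mono mult_left_mono less) fastforce+
      also have "\<dots> = (\<Sum>i\<in>I. s i * exp (- (d * real (len i)))) * (C * exp (d * real L))"
        unfolding sum_distrib_right
      proof (rule sum.cong[OF refl])
        fix i assume "i \<in> I"
        then have "len i \<le> L" using range True by fastforce
        then have "exp (d * real (L - len i)) = exp (- (d * real (len i))) * exp (d * real L)"
          by (simp add: of_nat_diff algebra_simps flip: exp_add)
        then show "s i * (C * exp (d * real (L - len i)))
            = s i * exp (- (d * real (len i))) * (C * exp (d * real L))"
          by simp
      qed
      also have "\<dots> \<le> 1 * (C * exp (d * real L))"
        using weight C by (intro mult_right_mono) auto
      finally show ?thesis by simp
    qed
  qed
  then show ?thesis by blast
qed

section \<open>Prefixes and factors\<close>

definition prefixes :: "nat word set \<Rightarrow> nat \<Rightarrow> nat list set" where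
  "prefixes X n = prefix n ` X"

definition finite_words :: "nat \<Rightarrow> nat \<Rightarrow> nat list set" where
  "finite_words q n = {v. set v \<subseteq> {..<q} \<and> length v = n}"

lemma finite_finite_words [simp]: "finite (finite_words q n)"
  and card_finite_words: "card (finite_words q n) = q ^ n"
  unfolding finite_words_def by (simp_all add: finite_lists_length_eq card_lists_length_eq)

lemma suffix_infinite_words: "w \<in> infinite_words q \<Longrightarrow> suffix i w \<in> infinite_words q"
  by (auto simp: infinite_words_def)

lemma prefixes_subset: "X \<subseteq> infinite_words q \<Longrightarrow> prefixes X n \<subseteq> finite_words q n"
  by (fastforce simp: prefixes_def finite_words_def infinite_words_def)

lemma finite_prefixes: "X \<subseteq> infinite_words q \<Longrightarrow> finite (prefixes X n)"
  using prefixes_subset finite_finite_words finite_subset by metis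

lemma card_prefixes_pos: "X \<subseteq> infinite_words q \<Longrightarrow> X \<noteq> {} \<Longrightarrow> 0 < card (prefixes X n)"
  by (metis card_gt_0_iff finite_prefixes image_is_empty prefixes_def)

text \<open>A factor of \<open>w\<close> is a prefix of a shifted copy of \<open>w\<close>. Statements about the prefixes of a
  shift-invariant set therefore cover the complexity of a single word, through its orbit, as well
  as the language of a subshift.\<close>

lemma factors_eq_prefixes_orbit: "factors w n = prefixes (range (\<lambda>i. suffix i w)) n"
proof (intro set_eqI iffI)
  fix v assume "v \<in> factors w n"
  then obtain v' v'' where v: "length v = n" "w = v' \<frown> v \<frown> v''"
    by (auto simp: factors_def)
  then have "v = prefix n (suffix (length v') w)"
    by (simp del: conc_conc)
  then show "v \<in> prefixes (range (\<lambda>i. suffix i w)) n"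
    unfolding prefixes_def by blast
next
  fix v assume "v \<in> prefixes (range (\<lambda>i. suffix i w)) n"
  then obtain i where v: "v = prefix n (suffix i w)" by (auto simp: prefixes_def)
  have "w = prefix i w \<frown> v \<frown> suffix n (suffix i w)"
    unfolding v by (simp only: prefix_suffix[symmetric])
  moreover have "length v = n" by (simp add: v)
  ultimately show "v \<in> factors w n" unfolding factors_def by blast
qed

lemma orbit_subset: "w \<in> infinite_words q \<Longrightarrow> range (\<lambda>i. suffix i w) \<subseteq> infinite_words q"
  by (auto simp: suffix_infinite_words)

lemma finite_factors: "w \<in> infinite_words q \<Longrightarrow> finite (factors w n)"
  unfolding factors_eq_prefixes_orbit by (rule finite_prefixes[OF orbit_subset])

lemma factors_subset: "w \<in> infinite_words q \<Longrightarrow> factors w n \<subseteq> finite_words q n"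
  unfolding factors_eq_prefixes_orbit by (rule prefixes_subset[OF orbit_subset])

lemma factors_suffix_subset: "factors (suffix i w) n \<subseteq> factors w n"
  unfolding factors_eq_prefixes_orbit prefixes_def by auto

lemma prefix_mem_factors: "prefix n (suffix i w) \<in> factors w n"
  unfolding factors_eq_prefixes_orbit prefixes_def by blast

lemma prefix_eq_iff: "prefix m x = prefix m y \<longleftrightarrow> (\<forall>i<m. x i = y i)"
  by (auto simp: list_eq_iff_nth_eq)

lemma prefix_add: "prefix (m + n) x = prefix m x @ prefix n (suffix m x)"
  by (simp add: subsequence_append)

lemma prefixes_submultiplicative:
  assumes "X \<subseteq> infinite_words q" and "\<And>x. x \<in> X \<Longrightarrow> suffix m x \<in> X"
  shows "card (prefixes X (m + n)) \<le> card (prefixes X m) * card (prefixes X n)"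
proof -
  have "prefixes X (m + n) \<subseteq> (\<lambda>(u, v). u @ v) ` (prefixes X m \<times> prefixes X n)"
    using assms(2) by (force simp: prefixes_def prefix_add)
  then have "card (prefixes X (m + n)) \<le> card (prefixes X m \<times> prefixes X n)"
    using finite_prefixes[OF assms(1)] by (meson finite_SigmaI surj_card_le)
  then show ?thesis by (simp add: card_cartesian_product)
qed

lemma prefixes_growth_convergent:
  assumes "X \<subseteq> infinite_words q" "X \<noteq> {}" and "\<And>m x. x \<in> X \<Longrightarrow> suffix m x \<in> X"
  shows "convergent (\<lambda>n. 1 / real n * ln (real (card (prefixes X n))))"
  using assms
  by (intro submultiplicative_growth_convergent prefixes_submultiplicative card_prefixes_pos) auto

lemma complexity_pos: "w \<in> infinite_words q \<Longrightarrow> 0 < complexity w n"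
  unfolding complexity_def factors_eq_prefixes_orbit
  by (rule card_prefixes_pos[OF orbit_subset]) auto

lemma complexity_growth:
  assumes "w \<in> infinite_words q"
  shows "(\<lambda>n. 1 / real n * ln (real (complexity w n))) \<longlonglongrightarrow> entropy w"
proof -
  have "convergent (\<lambda>n. 1 / real n * ln (real (complexity w n)))"
    unfolding complexity_def factors_eq_prefixes_orbit
    by (rule prefixes_growth_convergent[OF orbit_subset[OF assms]]) auto
  then show ?thesis
    unfolding entropy_def by (simp add: convergent_LIMSEQ_iff)
qed

section \<open>The topology of the full shift\<close>

lemma topspace_full_shift: "topspace (full_shift q) = infinite_words q"
  by (auto simp: full_shift_def infinite_words_def PiE_iff)

lemma compact_space_full_shift: "compact_space (full_shift q)"
  unfolding full_shift_def
  by (simp add: compact_space_product_topology compact_space_discrete_topology)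

text \<open>The cylinders form a base: the boxes of the product topology restrict only finitely many
  coordinates, and single letters are open.\<close>

lemma openin_full_shift_iff:
  "openin (full_shift q) S \<longleftrightarrow> S \<subseteq> infinite_words q \<and>
     (\<forall>x\<in>S. \<exists>m. \<forall>y\<in>infinite_words q. prefix m y = prefix m x \<longrightarrow> y \<in> S)"
  (is "?lhs \<longleftrightarrow> ?rhs")
proof
  assume S: ?lhs
  have "\<exists>m. \<forall>y\<in>infinite_words q. prefix m y = prefix m x \<longrightarrow> y \<in> S" if "x \<in> S" for x
  proof -
    obtain U where fin: "finite {i. U i \<noteq> {..<q}}" and x: "x \<in> Pi\<^sub>E UNIV U"
        and sub: "Pi\<^sub>E UNIV U \<subseteq> S"
      using S \<open>x \<in> S\<close> unfolding full_shift_def openin_product_topology_alt by auto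
    obtain m where m: "\<And>i. U i \<noteq> {..<q} \<Longrightarrow> i < m"
      using fin unfolding finite_nat_set_iff_bounded by blast
    have "y \<in> S" if "y \<in> infinite_words q" "prefix m y = prefix m x" for y
    proof -
      have "y i \<in> U i" for i
      proof (cases "i < m")
        case True
        then show ?thesis using that(2) x by (auto simp: prefix_eq_iff PiE_iff)
      next
        case False
        then show ?thesis using that(1) m[of i] by (auto simp: infinite_words_def)
      qed
      then show ?thesis using sub by (auto simp: PiE_iff)
    qed
    then show ?thesis by blast
  qed
  moreover have "S \<subseteq> infinite_words q"
    using openin_subset[OF S] by (simp add: topspace_full_shift)
  ultimately show ?rhs by blast
next
  assume S: ?rhs
  show ?lhs
    unfolding full_shift_def openin_product_topology_alt
  proof
    fix x assume "x \<in> S"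
    then obtain m where m: "\<And>y. y \<in> infinite_words q \<Longrightarrow> prefix m y = prefix m x \<Longrightarrow> y \<in> S"
      using S by blast
    have x: "x i < q" for i using \<open>x \<in> S\<close> S by (auto simp: infinite_words_def)
    \<comment> \<open>the box defining the cylinder of \<open>prefix m x\<close>\<close>
    let ?U = "\<lambda>i. if i < m then {x i} else {..<q}"
    have "finite {i \<in> UNIV. ?U i \<noteq> topspace (discrete_topology {..<q})}"
      by (rule finite_subset[of _ "{..<m}"]) auto
    moreover have "y \<in> S" if "y \<in> Pi\<^sub>E UNIV ?U" for y
    proof (rule m)
      have y: "y i \<in> ?U i" for i using that by (auto simp: PiE_iff simp del: if_split)
      show "prefix m y = prefix m x" unfolding prefix_eq_iff using y by (metis singletonD)
      show "y \<in> infinite_words q"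
        unfolding infinite_words_def using y x by (force split: if_splits)
    qed
    ultimately show "\<exists>U. finite {i \<in> UNIV. U i \<noteq> topspace (discrete_topology {..<q})} \<and>
        (\<forall>i\<in>UNIV. openin (discrete_topology {..<q}) (U i)) \<and> x \<in> Pi\<^sub>E UNIV U \<and> Pi\<^sub>E UNIV U \<subseteq> S"
      using x by (intro exI[of _ ?U]) auto
  qed
qed

lemma openin_prefix_condition: "openin (full_shift q) {x \<in> infinite_words q. Q (prefix m x)}"
  unfolding openin_full_shift_iff by (fastforce intro: exI[of _ m])

section \<open>Words made of few blocks\<close>

text \<open>The words that, cut into \<open>k\<close> consecutive blocks of length \<open>n\<close>, use few different blocks. Only the
  blocks at multiples of \<open>n\<close> are restricted, not all factors of length \<open>n\<close>; this makes the words with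
  a given set \<open>F\<close> of blocks easy to count.\<close>

definition block_words :: "nat \<Rightarrow> real \<Rightarrow> nat \<Rightarrow> nat \<Rightarrow> nat list set" where
  "block_words q c n k =
     (\<Union>F\<in>{F. F \<subseteq> finite_words q n \<and> real (card F) \<le> exp (c * real n)}.
        concat ` {us. set us \<subseteq> F \<and> length us = k})"

text \<open>There are at most \<open>2 ^ (q ^ n)\<close> sets \<open>F\<close> of allowed blocks, a number independent of \<open>k\<close>, and
  each of them yields at most \<open>card F ^ k\<close> words. So for fixed \<open>n\<close> the exponential rate of the
  count is \<open>c\<close> per letter.\<close>

lemma finite_block_words: "finite (block_words q c n k)"
  and card_block_words:
    "real (card (block_words q c n k)) \<le> 2 ^ (q ^ n) * exp (c * real n) ^ k"
proof -
  let ?\<F> = "{F. F \<subseteq> finite_words q n \<and> real (card F) \<le> exp (c * real n)}"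
  let ?W = "\<lambda>F. concat ` {us. set us \<subseteq> F \<and> length us = k}"
  have sub: "?\<F> \<subseteq> Pow (finite_words q n)" by blast
  have fin\<F>: "finite ?\<F>" using sub by (rule finite_subset) simp
  have finF: "finite F" if "F \<in> ?\<F>" for F
    using that finite_finite_words finite_subset by blast
  show "finite (block_words q c n k)"
    unfolding block_words_def
    using fin\<F> finF by (intro finite_UN_I finite_imageI finite_lists_length_eq)
  have card_W: "real (card (?W F)) \<le> exp (c * real n) ^ k" if "F \<in> ?\<F>" for F
  proof -
    have "card (?W F) \<le> card F ^ k"
      using card_image_le[OF finite_lists_length_eq[OF finF[OF that]]]
        card_lists_length_eq[OF finF[OF that]] by metis
    then have "real (card (?W F)) \<le> real (card F) ^ k"
      using of_nat_mono by fastforce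
    also have "\<dots> \<le> exp (c * real n) ^ k"
      using that by (intro power_mono) auto
    finally show ?thesis .
  qed
  have "card ?\<F> \<le> 2 ^ (q ^ n)"
    using card_mono[OF _ sub] by (simp add: card_Pow card_finite_words)
  then have card_\<F>: "real (card ?\<F>) \<le> 2 ^ (q ^ n)"
    by (metis of_nat_le_iff of_nat_numeral of_nat_power)
  have "real (card (block_words q c n k)) \<le> real (\<Sum>F\<in>?\<F>. card (?W F))"
    unfolding block_words_def by (intro of_nat_mono card_UN_le fin\<F>)
  also have "\<dots> \<le> real (card ?\<F>) * exp (c * real n) ^ k"
    unfolding of_nat_sum using card_W by (intro sum_bounded_above) blast
  also have "\<dots> \<le> 2 ^ (q ^ n) * exp (c * real n) ^ k"
    using card_\<F> by (intro mult_right_mono) auto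
  finally show "real (card (block_words q c n k)) \<le> 2 ^ (q ^ n) * exp (c * real n) ^ k" .
qed

lemma prefix_eq_concat:
  fixes x :: "'a word"
  shows
  "prefix (k * n) x = concat (map (\<lambda>j. prefix n (suffix (j * n) x)) [0..<k])"
proof (induction k)
  case (Suc k)
  have "prefix (Suc k * n) x = prefix (k * n) x @ prefix n (suffix (k * n) x)"
    by (simp only: mult_Suc add.commute[of n] prefix_add)
  moreover have "map f [0..<Suc k] = map f [0..<k] @ [f k]" for f :: "nat \<Rightarrow> 'a list"
    by simp
  ultimately show ?case
    by (simp only: Suc.IH concat_append concat.simps append_Nil2)
qed simp

lemma prefix_mem_block_words:
  assumes "x \<in> infinite_words q" and "real (complexity x n) \<le> exp (c * real n)"
  shows "prefix (k * n) x \<in> block_words q c n k"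
proof -
  let ?us = "map (\<lambda>j. prefix n (suffix (j * n) x)) [0..<k]"
  have "set ?us \<subseteq> factors x n" using prefix_mem_factors by fastforce
  then have "prefix (k * n) x \<in> concat ` {us. set us \<subseteq> factors x n \<and> length us = k}"
    unfolding prefix_eq_concat by (intro imageI) auto
  then show ?thesis
    using assms(2) factors_subset[OF assms(1)] unfolding block_words_def complexity_def by blast
qed

text \<open>The bound \<open>(1 / 2) ^ n\<close> is chosen so that the discounted counts add up to at most 1 over
  all \<open>n \<ge> 1\<close>, as \<open>renewal_bound\<close> requires.\<close>

lemma block_count_beats_exponential:
  fixes c d :: real
  assumes "c < d" "1 \<le> n"
  shows "\<exists>k\<ge>1. real (card (block_words q c n k)) * exp (- (d * real (k * n))) \<le> (1 / 2) ^ n"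
proof -
  define r where "r = exp (- ((d - c) * real n))"
  have r: "0 < r" "r < 1" unfolding r_def using assms by auto
  \<comment> \<open>passing to \<open>Suc k\<close> below keeps the estimate, since \<open>r < 1\<close>, and makes the length positive\<close>
  obtain k where k: "r ^ k < (1 / 2) ^ n / 2 ^ (q ^ n)"
    using real_arch_pow_inv[of "(1 / 2) ^ n / 2 ^ (q ^ n)" r] r by auto
  have rk: "r ^ Suc k \<le> (1 / 2) ^ n / 2 ^ (q ^ n)"
    using power_decreasing[of k "Suc k" r] k r by linarith
  have exp_eq: "exp (c * real n) ^ Suc k * exp (- (d * real (Suc k * n))) = r ^ Suc k"
    unfolding r_def exp_of_nat_mult[symmetric] exp_add[symmetric] by (simp add: algebra_simps)
  have "real (card (block_words q c n (Suc k))) * exp (- (d * real (Suc k * n)))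
      \<le> 2 ^ (q ^ n) * exp (c * real n) ^ Suc k * exp (- (d * real (Suc k * n)))"
    by (intro mult_right_mono card_block_words) simp
  also have "\<dots> = 2 ^ (q ^ n) * r ^ Suc k"
    unfolding exp_eq[symmetric] by (simp only: mult.assoc)
  also have "\<dots> \<le> 2 ^ (q ^ n) * ((1 / 2) ^ n / 2 ^ (q ^ n))"
    by (intro mult_left_mono rk) simp
  finally show ?thesis by (intro exI[of _ "Suc k"]) simp
qed

section \<open>Shift spaces\<close>

locale shift_space =
  fixes q :: nat and X :: "nat word set"
  assumes closed: "closedin (full_shift q) X"
    and suffix_mem: "x \<in> X \<Longrightarrow> suffix m x \<in> X"
begin

lemma subset_infinite_words: "X \<subseteq> infinite_words q"
  using closedin_subset[OF closed] by (simp add: topspace_full_shift)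

lemma topspace_space: "topspace (subtopology (full_shift q) X) = X"
  using subset_infinite_words by (auto simp: topspace_full_shift)

text \<open>Compactness in combinatorial form: the sets of words whose prefix of length \<open>m\<close> satisfies \<open>Q\<close>
  are open, so if they cover \<open>X\<close>, finitely many lengths suffice.\<close>

lemma bounded_prefix_length:
  assumes "\<And>x. x \<in> X \<Longrightarrow> \<exists>m. Q (prefix m x)"
  obtains B where "\<And>x. x \<in> X \<Longrightarrow> \<exists>m\<le>B. Q (prefix m x)"
proof -
  let ?G = "\<lambda>m. {x \<in> infinite_words q. Q (prefix m x)}"
  have "compactin (full_shift q) X"
    using closedin_compact_space[OF compact_space_full_shift closed] .
  moreover have "\<forall>U\<in>range ?G. openin (full_shift q) U"
    using openin_prefix_condition by blast
  moreover have "X \<subseteq> \<Union>(range ?G)"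
    using assms subset_infinite_words by blast
  ultimately obtain \<F> where \<F>: "finite \<F>" "\<F> \<subseteq> range ?G" "X \<subseteq> \<Union>\<F>"
    unfolding compactin_def by meson
  then obtain M where M: "finite M" "\<F> = ?G ` M"
    by (meson finite_subset_image)
  then obtain B where B: "\<And>m. m \<in> M \<Longrightarrow> m \<le> B"
    by (auto simp: finite_nat_set_iff_bounded_le)
  have "\<exists>m\<le>B. Q (prefix m x)" if "x \<in> X" for x
    using \<F>(3) that B unfolding M(2) by blast
  then show ?thesis by (rule that)
qed

lemma language_eq_prefixes: "(\<Union>w\<in>X. factors w n) = prefixes X n"
proof
  show "prefixes X n \<subseteq> (\<Union>w\<in>X. factors w n)"
    using prefix_mem_factors[where i = 0] by (fastforce simp: prefixes_def)
  show "(\<Union>w\<in>X. factors w n) \<subseteq> prefixes X n"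
    using suffix_mem unfolding factors_eq_prefixes_orbit prefixes_def by blast
qed

text \<open>The heart of the argument. Each \<open>x\<close> in \<open>X\<close> has few factors of some length \<open>n\<close>, hence the prefix
  of \<open>x\<close> of length \<open>k n * n\<close> is one of few block words, for any choice of \<open>k n\<close>; take \<open>k n\<close> so large
  that the counts are summable after discounting. The lengths needed are bounded by compactness,
  although \<open>n\<close> depends on \<open>x\<close>. What follows the prefix is again a word of \<open>X\<close>, so long words of the
  language are obtained by prepending a block word to a shorter one, and \<open>renewal_bound\<close> applies.\<close>

lemma prefixes_bound_of_small_complexity:
  assumes small: "\<And>x. x \<in> X \<Longrightarrow> \<exists>n\<ge>1. real (complexity x n) \<le> exp (c * real n)"
    and cd: "c < d" and d: "0 \<le> d"
  shows "\<exists>C. \<forall>L. real (card (prefixes X L)) \<le> C * exp (d * real L)"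
proof -
  obtain k where k: "\<And>n. 1 \<le> n \<Longrightarrow> 1 \<le> k n"
      "\<And>n. 1 \<le> n \<Longrightarrow>
         real (card (block_words q c n (k n))) * exp (- (d * real (k n * n))) \<le> (1 / 2) ^ n"
    using block_count_beats_exponential[OF cd, of _ q] by metis
  define Q where "Q v \<longleftrightarrow> (\<exists>n\<ge>1. length v = k n * n \<and> v \<in> block_words q c n (k n))" for v
  have "\<exists>m. Q (prefix m x)" if x: "x \<in> X" for x
  proof -
    obtain n where "n \<ge> 1" "real (complexity x n) \<le> exp (c * real n)"
      using small[OF x] by blast
    then have "Q (prefix (k n * n) x)"
      unfolding Q_def using x subset_infinite_words
      by (intro exI[of _ n]) (auto intro!: prefix_mem_block_words)
    then show ?thesis by blast
  qed
  then obtain B where B: "\<And>x. x \<in> X \<Longrightarrow> \<exists>m\<le>B. Q (prefix m x)"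
    using bounded_prefix_length by blast
  define I where "I = {n. 1 \<le> n \<and> k n * n \<le> B}"
  have I: "I \<subseteq> {1..B}"
  proof
    fix n assume "n \<in> I"
    then have n: "1 \<le> n" "k n * n \<le> B" by (auto simp: I_def)
    have "1 * n \<le> k n * n" by (rule mult_right_mono[OF k(1)[OF n(1)]]) simp
    then show "n \<in> {1..B}" using n unfolding atLeastAtMost_iff by linarith
  qed
  then have finI: "finite I" by (rule finite_subset) simp
  show ?thesis
  proof (rule renewal_bound[where B = B and I = I and len = "\<lambda>n. k n * n"
        and s = "\<lambda>n. real (card (block_words q c n (k n)))"])
    fix L assume L: "B \<le> L"
    let ?P = "\<lambda>n. block_words q c n (k n) \<times> prefixes X (L - k n * n)"
    have finP: "finite (?P n)" for n
      using finite_block_words finite_prefixes[OF subset_infinite_words] by blast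
    have "prefixes X L \<subseteq> (\<Union>n\<in>I. (\<lambda>(u, v). u @ v) ` ?P n)"
    proof
      fix v assume "v \<in> prefixes X L"
      then obtain x where x: "x \<in> X" "v = prefix L x" by (auto simp: prefixes_def)
      obtain m where m: "m \<le> B" "Q (prefix m x)" using B[OF x(1)] by blast
      then obtain n where n: "1 \<le> n" "m = k n * n" "prefix m x \<in> block_words q c n (k n)"
        unfolding Q_def by auto
      have "v = prefix m x @ prefix (L - m) (suffix m x)"
        using prefix_add[where m = m and n = "L - m" and x = x] m(1) L x(2) by simp
      moreover have "prefix (L - m) (suffix m x) \<in> prefixes X (L - m)"
        using suffix_mem[OF x(1)] by (auto simp: prefixes_def simp del: subsequence_shift)
      moreover have "n \<in> I" using n m(1) by (simp add: I_def)
      ultimately show "v \<in> (\<Union>n\<in>I. (\<lambda>(u, v). u @ v) ` ?P n)"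
        using n by blast
    qed
    then have "card (prefixes X L) \<le> card (\<Union>n\<in>I. (\<lambda>(u, v). u @ v) ` ?P n)"
      using finP by (intro card_mono finite_UN_I finI finite_imageI)
    also have "\<dots> \<le> (\<Sum>n\<in>I. card ((\<lambda>(u, v). u @ v) ` ?P n))"
      by (rule card_UN_le[OF finI])
    also have "\<dots> \<le> (\<Sum>n\<in>I. card (?P n))"
      by (intro sum_mono card_image_le finP)
    finally have "real (card (prefixes X L)) \<le> real (\<Sum>n\<in>I. card (?P n))"
      by (rule of_nat_mono)
    then show "real (card (prefixes X L))
        \<le> (\<Sum>n\<in>I. real (card (block_words q c n (k n))) * real (card (prefixes X (L - k n * n))))"
      by (simp add: card_cartesian_product)
  next
    fix n assume "n \<in> I"
    then show "1 \<le> k n * n \<and> k n * n \<le> B"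
      using k(1)[of n] unfolding I_def by auto
  next
    have "(\<Sum>n\<in>I. real (card (block_words q c n (k n))) * exp (- (d * real (k n * n))))
        \<le> (\<Sum>n\<in>I. (1 / 2) ^ n)"
      using k(2) by (intro sum_mono) (simp add: I_def)
    also have "\<dots> \<le> (\<Sum>n=1..B. (1 / 2) ^ n)"
      using I by (intro sum_mono2) auto
    also have "\<dots> = 1 - (1 / 2) ^ B"
      by (induction B) auto
    also have "\<dots> \<le> 1" by simp
    finally show "(\<Sum>n\<in>I. real (card (block_words q c n (k n))) * exp (- (d * real (k n * n)))) \<le> 1" .
  qed (use d in auto)
qed

lemma entropy_nonneg:
  assumes "w \<in> X"
  shows "0 \<le> entropy w"
proof -
  have w: "w \<in> infinite_words q" using assms subset_infinite_words by blast
  show ?thesis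
    by (rule LIMSEQ_le_const[OF complexity_growth[OF w]])
      (use complexity_pos[OF w] in \<open>auto simp: Suc_leI\<close>)
qed

lemma entropy_le_growth:
  assumes h: "(\<lambda>n. 1 / real n * ln (real (card (prefixes X n)))) \<longlonglongrightarrow> h" and w: "w \<in> X"
  shows "entropy w \<le> h"
proof (rule LIMSEQ_le[OF complexity_growth h])
  show w': "w \<in> infinite_words q" using w subset_infinite_words by blast
  have "complexity w n \<le> card (prefixes X n)" for n
    unfolding complexity_def
    by (rule card_mono[OF finite_prefixes[OF subset_infinite_words]])
      (use w in \<open>auto simp flip: language_eq_prefixes\<close>)
  then show "\<exists>N. \<forall>n\<ge>N. 1 / real n * ln (real (complexity w n))
      \<le> 1 / real n * ln (real (card (prefixes X n)))"
    using complexity_pos[OF w'] by (intro exI allI impI mult_left_mono ln_mono) auto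
qed

text \<open>If the entropies of the words stayed below some \<open>c < h\<close>, then each word would have fewer than
  \<open>exp (c n)\<close> factors of some length \<open>n\<close>, and \<open>prefixes_bound_of_small_complexity\<close> would make the
  language grow at a rate strictly below \<open>h\<close>.\<close>

theorem growth_eq_SUP_entropy:
  assumes h: "(\<lambda>n. 1 / real n * ln (real (card (prefixes X n)))) \<longlonglongrightarrow> h" and ne: "X \<noteq> {}"
  shows "(SUP w\<in>X. ereal (entropy w)) = ereal h"
proof (rule antisym)
  show "(SUP w\<in>X. ereal (entropy w)) \<le> ereal h"
    by (rule SUP_least) (simp add: entropy_le_growth[OF h])
  show "ereal h \<le> (SUP w\<in>X. ereal (entropy w))"
  proof (rule ccontr)
    assume "\<not> ereal h \<le> (SUP w\<in>X. ereal (entropy w))"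
    then obtain c where c: "(SUP w\<in>X. ereal (entropy w)) < ereal c" "ereal c < ereal h"
      using ereal_dense2 not_le by metis
    have below: "entropy x < c" if "x \<in> X" for x
      using le_less_trans[OF SUP_upper[OF that] c(1)] by simp
    \<comment> \<open>\<open>d\<close> leaves room for the loss in \<open>block_count_beats_exponential\<close>\<close>
    obtain d where d: "c < d" "d < h" using c(2) dense by auto
    obtain w where "w \<in> X" using ne by blast
    then have "0 \<le> d" using entropy_nonneg[of w] below[of w] d by linarith
    have small: "\<exists>n\<ge>1. real (complexity x n) \<le> exp (c * real n)" if x: "x \<in> X" for x
    proof -
      have x': "x \<in> infinite_words q" using x subset_infinite_words by blast
      have "\<forall>\<^sub>F n in sequentially. 1 / real n * ln (real (complexity x n)) < c"
        using order_tendstoD(2)[OF complexity_growth[OF x'] below[OF x]] .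
      then have "\<forall>\<^sub>F n in sequentially. 1 \<le> n \<and> 1 / real n * ln (real (complexity x n)) < c"
        by (rule eventually_conj[OF eventually_ge_at_top])
      then obtain n where n: "1 \<le> n" "1 / real n * ln (real (complexity x n)) < c"
        using eventually_happens'[OF sequentially_bot] by blast
      then have "ln (real (complexity x n)) \<le> c * real n"
        by (simp add: field_simps)
      then have "exp (ln (real (complexity x n))) \<le> exp (c * real n)"
        by (simp only: exp_le_cancel_iff)
      then have "real (complexity x n) \<le> exp (c * real n)"
        using complexity_pos[OF x', of n] by simp
      then show ?thesis using n(1) by blast
    qed
    obtain C where "\<And>L. real (card (prefixes X L)) \<le> C * exp (d * real L)"
      using prefixes_bound_of_small_complexity[OF small d(1) \<open>0 \<le> d\<close>] by blast
    then have "h \<le> d"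
      by (rule growth_rate_le[OF h _ card_prefixes_pos[OF subset_infinite_words ne]])
    then show False using d(2) by simp
  qed
qed

end

section \<open>Topological entropy of a shift space\<close>

lemma subcover_number_le:
  "\<V> \<subseteq> \<U> \<Longrightarrow> finite \<V> \<Longrightarrow> \<Union>\<V> = topspace X \<Longrightarrow> subcover_number X \<U> \<le> card \<V>"
  unfolding subcover_number_def by (rule Least_le) blast

lemma subcover_number_attained:
  assumes "\<V> \<subseteq> \<U>" "finite \<V>" "\<Union>\<V> = topspace X"
  obtains \<W> where "\<W> \<subseteq> \<U>" "finite \<W>" "card \<W> = subcover_number X \<U>" "\<Union>\<W> = topspace X"
proof -
  have "\<exists>k \<V>. \<V> \<subseteq> \<U> \<and> finite \<V> \<and> card \<V> = k \<and> \<Union>\<V> = topspace X"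
    using assms by blast
  from LeastI_ex[OF this] show ?thesis
    using that unfolding subcover_number_def by blast
qed

lemma funpow_shift: "(shift ^^ i) x = suffix i x"
  by (induction i) (simp_all add: shift_def)

context shift_space
begin

abbreviation X_top where "X_top \<equiv> subtopology (full_shift q) X"

abbreviation join_number :: "nat word set set \<Rightarrow> nat \<Rightarrow> nat" where
  "join_number \<U> n \<equiv> subcover_number X_top (iterated_join X_top shift \<U> n)"

lemma iterated_join_eq:
  "iterated_join X_top shift \<U> n = {{x \<in> X. \<forall>i<n. suffix i x \<in> c i} | c. \<forall>i<n. c i \<in> \<U>}"
  unfolding iterated_join_def topspace_space funpow_shift ..

lemma iterated_joinI:
  "\<forall>i<n. c i \<in> \<U> \<Longrightarrow> {x \<in> X. \<forall>i<n. suffix i x \<in> c i} \<in> iterated_join X_top shift \<U> n"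
  unfolding iterated_join_eq by blast

lemma iterated_joinE:
  assumes "V \<in> iterated_join X_top shift \<U> n"
  obtains c where "V = {x \<in> X. \<forall>i<n. suffix i x \<in> c i}" "\<forall>i<n. c i \<in> \<U>"
  using assms unfolding iterated_join_eq by (elim CollectE exE conjE) (rule that)

text \<open>A Lebesgue number for the cover: membership in some element is decided by the first \<open>B\<close> letters,
  with the same \<open>B\<close> for all words.\<close>

lemma uniform_window:
  assumes "open_cover X_top \<U>"
  shows "\<exists>B. \<forall>x\<in>X. \<exists>U\<in>\<U>. \<forall>y\<in>X. prefix B y = prefix B x \<longrightarrow> y \<in> U"
proof -
  define Q where "Q v \<longleftrightarrow> (\<exists>U\<in>\<U>. \<forall>y\<in>X. prefix (length v) y = v \<longrightarrow> y \<in> U)" for v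
  have "\<exists>m. Q (prefix m x)" if x: "x \<in> X" for x
  proof -
    obtain U where U: "U \<in> \<U>" "x \<in> U" "openin X_top U"
      using assms x unfolding open_cover_def topspace_space by blast
    then obtain S where S: "openin (full_shift q) S" "U = S \<inter> X"
      unfolding openin_subtopology by blast
    then obtain m where "\<forall>y\<in>infinite_words q. prefix m y = prefix m x \<longrightarrow> y \<in> S"
      using U(2) unfolding openin_full_shift_iff by blast
    then have "\<forall>y\<in>X. prefix m y = prefix m x \<longrightarrow> y \<in> U"
      using S(2) subset_infinite_words by blast
    then have "Q (prefix m x)" unfolding Q_def using U(1) by auto
    then show ?thesis ..
  qed
  then obtain B where B: "\<And>x. x \<in> X \<Longrightarrow> \<exists>m\<le>B. Q (prefix m x)" using bounded_prefix_length by blast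
  have "\<exists>U\<in>\<U>. \<forall>y\<in>X. prefix B y = prefix B x \<longrightarrow> y \<in> U" if x: "x \<in> X" for x
  proof -
    obtain m U where m: "m \<le> B" "U \<in> \<U>" "\<forall>y\<in>X. prefix m y = prefix m x \<longrightarrow> y \<in> U"
      using B[OF x] unfolding Q_def by auto
    have "prefix m y = prefix m x" if "prefix B y = prefix B x" for y
      using that m(1) unfolding prefix_eq_iff by simp
    then show ?thesis using m by blast
  qed
  then show ?thesis by blast
qed

text \<open>The prefix of length \<open>n + B\<close> of \<open>x\<close> determines the first \<open>B\<close> letters of each of the words
  \<open>suffix i x\<close> with \<open>i < n\<close>, hence an element of the join that contains \<open>x\<close>. One element for each such
  prefix covers \<open>X\<close>.\<close>

lemma join_subcover:
  assumes "open_cover X_top \<U>"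
  shows "\<exists>B. \<forall>n. \<exists>\<V>\<subseteq>iterated_join X_top shift \<U> n.
      finite \<V> \<and> card \<V> \<le> card (prefixes X (n + B)) \<and> \<Union>\<V> = topspace X_top"
proof -
  obtain B where "\<forall>x\<in>X. \<exists>U\<in>\<U>. \<forall>y\<in>X. prefix B y = prefix B x \<longrightarrow> y \<in> U"
    using uniform_window[OF assms] ..
  then obtain U where U: "\<And>x. x \<in> X \<Longrightarrow> U x \<in> \<U>"
      "\<And>x y. x \<in> X \<Longrightarrow> y \<in> X \<Longrightarrow> prefix B y = prefix B x \<Longrightarrow> y \<in> U x"
    by metis
  have "\<exists>\<V>\<subseteq>iterated_join X_top shift \<U> n.
      finite \<V> \<and> card \<V> \<le> card (prefixes X (n + B)) \<and> \<Union>\<V> = topspace X_top" for n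
  proof -
    \<comment> \<open>the word \<open>rep v\<close> of \<open>X\<close> represents the cylinder of \<open>v\<close>\<close>
    define rep where "rep = inv_into X (prefix (n + B))"
    have rep: "rep v \<in> X" "prefix (n + B) (rep v) = v" if "v \<in> prefixes X (n + B)" for v
      using that unfolding rep_def prefixes_def by (rule inv_into_into, rule f_inv_into_f)
    define D where "D v = {x \<in> X. \<forall>i<n. suffix i x \<in> U (suffix i (rep v))}" for v
    let ?\<V> = "D ` prefixes X (n + B)"
    have fin: "finite (prefixes X (n + B))" by (rule finite_prefixes[OF subset_infinite_words])
    have "?\<V> \<subseteq> iterated_join X_top shift \<U> n"
    proof (rule image_subsetI)
      fix v assume v: "v \<in> prefixes X (n + B)"
      have "U (suffix i (rep v)) \<in> \<U>" for i by (rule U(1)[OF suffix_mem[OF rep(1)[OF v]]])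
      then show "D v \<in> iterated_join X_top shift \<U> n"
        unfolding D_def by (intro iterated_joinI) simp
    qed
    moreover have "\<Union>?\<V> = X"
    proof
      show "\<Union>?\<V> \<subseteq> X" by (auto simp: D_def)
      show "X \<subseteq> \<Union>?\<V>"
      proof
        fix x assume x: "x \<in> X"
        let ?v = "prefix (n + B) x"
        have v: "?v \<in> prefixes X (n + B)" using x by (auto simp: prefixes_def)
        have "suffix i x \<in> U (suffix i (rep ?v))" if "i < n" for i
        proof (rule U(2)[OF suffix_mem[OF rep(1)[OF v]] suffix_mem[OF x]])
          show "prefix B (suffix i x) = prefix B (suffix i (rep ?v))"
            using rep(2)[OF v] that unfolding prefix_eq_iff by simp
        qed
        then have "x \<in> D ?v" using x by (simp add: D_def)
        then show "x \<in> \<Union>?\<V>" using v by blast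
      qed
    qed
    moreover have "finite ?\<V>" using fin by simp
    moreover have "card ?\<V> \<le> card (prefixes X (n + B))" by (rule card_image_le[OF fin])
    ultimately show ?thesis unfolding topspace_space by blast
  qed
  then show ?thesis by blast
qed

lemma join_number_attained:
  assumes "open_cover X_top \<U>"
  obtains \<W> where "\<W> \<subseteq> iterated_join X_top shift \<U> n" "finite \<W>"
    "card \<W> = join_number \<U> n" "\<Union>\<W> = X"
proof -
  obtain B where B: "\<forall>n. \<exists>\<V>\<subseteq>iterated_join X_top shift \<U> n.
      finite \<V> \<and> card \<V> \<le> card (prefixes X (n + B)) \<and> \<Union>\<V> = topspace X_top"
    using join_subcover[OF assms] ..
  obtain \<V> where \<V>: "\<V> \<subseteq> iterated_join X_top shift \<U> n" "finite \<V>"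
      "card \<V> \<le> card (prefixes X (n + B))" "\<Union>\<V> = topspace X_top"
    using spec[OF B, of n] by (elim exE conjE) (rule that)
  show ?thesis
    by (rule subcover_number_attained[OF \<V>(1,2,4)]) (rule that, simp_all only: topspace_space)
qed

lemma join_number_le:
  assumes "open_cover X_top \<U>"
  obtains B where "\<And>n. join_number \<U> n \<le> card (prefixes X (n + B))"
proof -
  obtain B where B: "\<forall>n. \<exists>\<V>\<subseteq>iterated_join X_top shift \<U> n.
      finite \<V> \<and> card \<V> \<le> card (prefixes X (n + B)) \<and> \<Union>\<V> = topspace X_top"
    using join_subcover[OF assms] ..
  have "join_number \<U> n \<le> card (prefixes X (n + B))" for n
  proof -
    obtain \<V> where \<V>: "\<V> \<subseteq> iterated_join X_top shift \<U> n" "finite \<V>"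
        "card \<V> \<le> card (prefixes X (n + B))" "\<Union>\<V> = topspace X_top"
      using spec[OF B, of n] by (elim exE conjE) (rule that)
    from subcover_number_le[OF \<V>(1,2,4)] \<V>(3) show ?thesis by (rule order_trans)
  qed
  then show ?thesis by (rule that)
qed

lemma join_number_submultiplicative:
  assumes "open_cover X_top \<U>"
  shows "join_number \<U> (m + n) \<le> join_number \<U> m * join_number \<U> n"
proof -
  obtain \<V> where \<V>: "\<V> \<subseteq> iterated_join X_top shift \<U> m" "finite \<V>"
      "card \<V> = join_number \<U> m" "\<Union>\<V> = X"
    by (rule join_number_attained[OF assms])
  obtain \<W> where \<W>: "\<W> \<subseteq> iterated_join X_top shift \<U> n" "finite \<W>"
      "card \<W> = join_number \<U> n" "\<Union>\<W> = X"
    by (rule join_number_attained[OF assms])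
  \<comment> \<open>\<open>V\<close> controls the first \<open>m\<close> positions of the orbit, \<open>W\<close> the \<open>n\<close> positions after them\<close>
  let ?f = "\<lambda>(V, W). {x \<in> V. suffix m x \<in> W}"
  let ?\<S> = "?f ` (\<V> \<times> \<W>)"
  have "?\<S> \<subseteq> iterated_join X_top shift \<U> (m + n)"
  proof (clarify)
    fix V W assume VW: "V \<in> \<V>" "W \<in> \<W>"
    obtain c where c: "V = {x \<in> X. \<forall>i<m. suffix i x \<in> c i}" "\<forall>i<m. c i \<in> \<U>"
      by (rule iterated_joinE[OF subsetD[OF \<V>(1) VW(1)]])
    obtain c' where c': "W = {x \<in> X. \<forall>i<n. suffix i x \<in> c' i}" "\<forall>i<n. c' i \<in> \<U>"
      by (rule iterated_joinE[OF subsetD[OF \<W>(1) VW(2)]])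
    let ?e = "\<lambda>i. if i < m then c i else c' (i - m)"
    have split: "(\<forall>i<m + n. P i) \<longleftrightarrow> (\<forall>i<m. P i) \<and> (\<forall>i<n. P (m + i))" for P :: "nat \<Rightarrow> bool"
      by (induction n) (auto simp: less_Suc_eq)
    have "\<forall>i<m + n. ?e i \<in> \<U>" using c(2) c'(2) unfolding split by simp
    moreover have "{x \<in> V. suffix m x \<in> W} = {x \<in> X. \<forall>i<m + n. suffix i x \<in> ?e i}"
      unfolding c(1) c'(1) split by (intro Collect_cong) (simp add: suffix_mem cong: conj_cong)
    ultimately show "{x \<in> V. suffix m x \<in> W} \<in> iterated_join X_top shift \<U> (m + n)"
      using iterated_joinI[of "m + n" ?e] by simp
  qed
  moreover have "\<Union>?\<S> = X"
  proof
    show "\<Union>?\<S> \<subseteq> X" using \<V>(4) by auto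
    show "X \<subseteq> \<Union>?\<S>"
    proof
      fix x assume x: "x \<in> X"
      obtain V where "V \<in> \<V>" "x \<in> V" using x \<V>(4) by blast
      moreover obtain W where "W \<in> \<W>" "suffix m x \<in> W" using suffix_mem[OF x] \<W>(4) by blast
      ultimately show "x \<in> \<Union>?\<S>" by (intro UnionI[of "?f (V, W)"]) auto
    qed
  qed
  moreover have fin: "finite (\<V> \<times> \<W>)" using \<V>(2) \<W>(2) by simp
  ultimately have "join_number \<U> (m + n) \<le> card ?\<S>"
    by (intro subcover_number_le) (simp_all only: topspace_space finite_imageI)
  also have "\<dots> \<le> card (\<V> \<times> \<W>)" by (rule card_image_le[OF fin])
  finally show ?thesis using \<V>(3) \<W>(3) by (simp only: card_cartesian_product)
qed

lemma join_number_pos: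
  assumes "open_cover X_top \<U>" "X \<noteq> {}"
  shows "0 < join_number \<U> n"
proof -
  obtain \<V> where "finite \<V>" "card \<V> = join_number \<U> n" "\<Union>\<V> = X"
    by (rule join_number_attained[OF assms(1)])
  then show ?thesis using assms(2) by (metis Union_empty card_gt_0_iff)
qed

lemma cover_growth:
  assumes "open_cover X_top \<U>" "X \<noteq> {}"
  obtains l where "(\<lambda>n. 1 / real n * ln (real (join_number \<U> n))) \<longlonglongrightarrow> l"
    "cover_entropy X_top shift \<U> = ereal l"
proof -
  have "convergent (\<lambda>n. 1 / real n * ln (real (join_number \<U> n)))"
    using assms
    by (intro submultiplicative_growth_convergent join_number_submultiplicative join_number_pos)
  then obtain l where l: "(\<lambda>n. 1 / real n * ln (real (join_number \<U> n))) \<longlonglongrightarrow> l"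
    unfolding convergent_def by blast
  have "ereal (1 / real n) * elog (join_number \<U> n)
      = ereal (1 / real n * ln (real (join_number \<U> n)))" for n
    using join_number_pos[OF assms, of n] by (simp add: elog_def)
  then have "cover_entropy X_top shift \<U> = ereal l"
    unfolding cover_entropy_def using l by (simp only: limI tendsto_ereal)
  with l show ?thesis by (rule that)
qed

text \<open>Lengthening the words from \<open>n\<close> to \<open>n + B\<close> costs at most the constant factor
  \<open>card (prefixes X B)\<close>, which the growth rate does not see.\<close>

lemma cover_entropy_le_growth:
  assumes h: "(\<lambda>n. 1 / real n * ln (real (card (prefixes X n)))) \<longlonglongrightarrow> h" and ne: "X \<noteq> {}"
    and cover: "open_cover X_top \<U>"
  shows "cover_entropy X_top shift \<U> \<le> ereal h"
proof -
  obtain l where l: "(\<lambda>n. 1 / real n * ln (real (join_number \<U> n))) \<longlonglongrightarrow> l"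
      "cover_entropy X_top shift \<U> = ereal l"
    by (rule cover_growth[OF cover ne])
  obtain B where B: "\<And>n. join_number \<U> n \<le> card (prefixes X (n + B))"
    using join_number_le[OF cover] by blast
  note pos = card_prefixes_pos[OF subset_infinite_words ne]
  let ?K = "ln (real (card (prefixes X B)))"
  have "(\<lambda>n. 1 / real n * ln (real (card (prefixes X n))) + ?K / real n) \<longlonglongrightarrow> h + 0"
    by (intro tendsto_add h lim_const_over_n)
  moreover have "1 / real n * ln (real (join_number \<U> n))
      \<le> 1 / real n * ln (real (card (prefixes X n))) + ?K / real n" for n
  proof -
    have "join_number \<U> n \<le> card (prefixes X n) * card (prefixes X B)"
      by (rule order_trans[OF B prefixes_submultiplicative[OF subset_infinite_words suffix_mem]])
    then have "real (join_number \<U> n) \<le> real (card (prefixes X n)) * real (card (prefixes X B))"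
      by (metis of_nat_le_iff of_nat_mult)
    then have "ln (real (join_number \<U> n))
        \<le> ln (real (card (prefixes X n)) * real (card (prefixes X B)))"
      using join_number_pos[OF cover ne, of n] by (intro ln_mono) auto
    also have "\<dots> = ln (real (card (prefixes X n))) + ?K"
      using pos by (intro ln_mult_pos) auto
    finally have "1 / real n * ln (real (join_number \<U> n))
        \<le> 1 / real n * (ln (real (card (prefixes X n))) + ?K)"
      by (intro mult_left_mono) auto
    then show ?thesis by (simp add: distrib_left)
  qed
  ultimately have "l \<le> h + 0"
    by (intro LIMSEQ_le[OF l(1)]) auto
  then show ?thesis using l(2) by simp
qed

text \<open>The partition by the first letter. The nonempty elements of its \<open>n\<close>-th join are the cylinders of
  the words of length \<open>n\<close> of the language. Being disjoint, they admit no proper subcover, so this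
  cover attains the topological entropy.\<close>

definition letter_cover :: "nat word set set" where
  "letter_cover = (\<lambda>a. {x \<in> X. x 0 = a}) ` {..<q}"

lemma open_cover_letter_cover: "open_cover X_top letter_cover"
  unfolding open_cover_def topspace_space
proof
  show "\<forall>U\<in>letter_cover. openin X_top U"
  proof
    fix U assume "U \<in> letter_cover"
    then obtain a where "U = {x \<in> X. x 0 = a}" by (auto simp: letter_cover_def)
    then have "U = {x \<in> infinite_words q. hd (prefix 1 x) = a} \<inter> X"
      using subset_infinite_words by auto
    moreover have "openin (full_shift q) {x \<in> infinite_words q. hd (prefix 1 x) = a}"
      by (rule openin_prefix_condition)
    ultimately show "openin X_top U" unfolding openin_subtopology by blast
  qed
  show "\<Union>letter_cover = X"
    using subset_infinite_words by (fastforce simp: letter_cover_def infinite_words_def)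
qed

lemma card_prefixes_le_join_number: "card (prefixes X n) \<le> join_number letter_cover n"
proof -
  obtain \<V> where \<V>: "\<V> \<subseteq> iterated_join X_top shift letter_cover n" "finite \<V>"
      "card \<V> = join_number letter_cover n" "\<Union>\<V> = X"
    by (rule join_number_attained[OF open_cover_letter_cover])
  have one: "card (prefixes V n) \<le> 1" if V: "V \<in> \<V>" for V
  proof -
    obtain c where c: "V = {x \<in> X. \<forall>i<n. suffix i x \<in> c i}" "\<forall>i<n. c i \<in> letter_cover"
      by (rule iterated_joinE[OF subsetD[OF \<V>(1) V]])
    have "prefix n x = prefix n y" if xy: "x \<in> V" "y \<in> V" for x y
      unfolding prefix_eq_iff
    proof (intro allI impI)
      fix i assume i: "i < n"
      then obtain a where "c i = {x \<in> X. x 0 = a}" using c(2) by (auto simp: letter_cover_def)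
      moreover have "suffix i x \<in> c i" "suffix i y \<in> c i" using xy i unfolding c(1) by auto
      ultimately show "x i = y i" by auto
    qed
    then have "\<forall>u\<in>prefixes V n. \<forall>v\<in>prefixes V n. u = v" unfolding prefixes_def by blast
    then show ?thesis
      by (cases "finite (prefixes V n)") (simp_all add: card_le_Suc0_iff_eq)
  qed
  have "prefixes X n = (\<Union>V\<in>\<V>. prefixes V n)"
    unfolding prefixes_def \<V>(4)[symmetric] by blast
  then have "card (prefixes X n) \<le> (\<Sum>V\<in>\<V>. card (prefixes V n))"
    using card_UN_le[OF \<V>(2)] by metis
  also have "\<dots> \<le> card \<V> * 1"
    using sum_bounded_above[of \<V> "\<lambda>V. card (prefixes V n)" 1] one by simp
  finally show ?thesis using \<V>(3) by simp
qed

theorem topological_entropy_eq_growth: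
  assumes h: "(\<lambda>n. 1 / real n * ln (real (card (prefixes X n)))) \<longlonglongrightarrow> h" and ne: "X \<noteq> {}"
  shows "topological_entropy X_top shift = ereal h"
proof (rule antisym)
  show "topological_entropy X_top shift \<le> ereal h"
    unfolding topological_entropy_def
    by (rule SUP_least) (simp add: cover_entropy_le_growth[OF h ne])
  obtain l where l: "(\<lambda>n. 1 / real n * ln (real (join_number letter_cover n))) \<longlonglongrightarrow> l"
      "cover_entropy X_top shift letter_cover = ereal l"
    by (rule cover_growth[OF open_cover_letter_cover ne])
  have "1 / real n * ln (real (card (prefixes X n)))
      \<le> 1 / real n * ln (real (join_number letter_cover n))" for n
    using card_prefixes_le_join_number[of n] card_prefixes_pos[OF subset_infinite_words ne, of n]
    by (intro mult_left_mono ln_mono) auto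
  then have "h \<le> l" by (intro LIMSEQ_le[OF h l(1)]) auto
  then have "ereal h \<le> cover_entropy X_top shift letter_cover" using l(2) by simp
  also have "\<dots> \<le> topological_entropy X_top shift"
    unfolding topological_entropy_def using open_cover_letter_cover by (intro SUP_upper) simp
  finally show "ereal h \<le> topological_entropy X_top shift" .
qed

text \<open>The empty set covers the empty space, so all joins need 0 elements, and the logarithm of 0 is
  \<open>-\<infinity>\<close>.\<close>

lemma topological_entropy_empty:
  assumes "X = {}"
  shows "topological_entropy X_top shift = -\<infinity>"
proof -
  have "cover_entropy X_top shift \<U> = -\<infinity>" for \<U>
  proof -
    have "join_number \<U> n = 0" for n
      using subcover_number_le[of "{}" _ X_top] assms by simp
    then have "\<forall>\<^sub>F n in sequentially. ereal (1 / real n) * elog (join_number \<U> n) = -\<infinity>"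
      using eventually_gt_at_top[of 0] by (auto simp: elog_def elim!: eventually_mono)
    then show ?thesis
      unfolding cover_entropy_def by (intro limI tendsto_eventually)
  qed
  moreover have "open_cover X_top {}" using assms by (simp add: open_cover_def)
  ultimately show ?thesis
    unfolding topological_entropy_def by (intro SUP_eqI) auto
qed

theorem growth_entropy_topological_entropy:
  "((\<lambda>n. ereal (1 / real n) * elog (card (prefixes X n))) \<longlonglongrightarrow> (SUP w\<in>X. ereal (entropy w)))
     \<and> (SUP w\<in>X. ereal (entropy w)) = topological_entropy X_top shift"
proof (cases "X = {}")
  case True
  have "\<forall>\<^sub>F n in sequentially. ereal (1 / real n) * elog (card (prefixes X n)) = -\<infinity>"
    using eventually_gt_at_top[of 0] True
    by (auto simp: elog_def prefixes_def elim!: eventually_mono)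
  then have "(\<lambda>n. ereal (1 / real n) * elog (card (prefixes X n))) \<longlonglongrightarrow> -\<infinity>"
    by (rule tendsto_eventually)
  moreover have "(SUP w\<in>X. ereal (entropy w)) = -\<infinity>"
    using True by (simp add: bot_ereal_def)
  ultimately show ?thesis using topological_entropy_empty[OF True] by simp
next
  case False
  obtain h where h: "(\<lambda>n. 1 / real n * ln (real (card (prefixes X n)))) \<longlonglongrightarrow> h"
    using prefixes_growth_convergent[OF subset_infinite_words False suffix_mem]
    unfolding convergent_def by blast
  have "ereal (1 / real n) * elog (card (prefixes X n))
      = ereal (1 / real n * ln (real (card (prefixes X n))))" for n
    using card_prefixes_pos[OF subset_infinite_words False, of n] by (simp add: elog_def)
  then have "(\<lambda>n. ereal (1 / real n) * elog (card (prefixes X n))) \<longlonglongrightarrow> ereal h"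
    using h by (simp only: tendsto_ereal)
  then show ?thesis
    using growth_eq_SUP_entropy[OF h False] topological_entropy_eq_growth[OF h False] by simp
qed

end

section \<open>Words of bounded complexity\<close>

text \<open>A violation of the complexity bound at one \<open>n\<close> is witnessed by finitely many factors, which all
  lie in a prefix of the word, so every word with that prefix violates the bound too.\<close>

lemma closedin_words_below: "closedin (full_shift q) (words_below q f)"
proof -
  have "\<exists>m. \<forall>y\<in>infinite_words q. prefix m y = prefix m x \<longrightarrow> y \<in> infinite_words q - words_below q f"
    if x: "x \<in> infinite_words q" "x \<notin> words_below q f" for x
  proof -
    obtain n where n: "f n < real (complexity x n)"
      using x by (auto simp: words_below_def not_le)
    have "\<exists>i. v = prefix n (suffix i x)" if "v \<in> factors x n" for v
      using that by (auto simp: factors_eq_prefixes_orbit prefixes_def)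
    then obtain pos where pos: "\<And>v. v \<in> factors x n \<Longrightarrow> v = prefix n (suffix (pos v) x)"
      by metis
    \<comment> \<open>all factors of length \<open>n\<close> occur in the prefix of length \<open>M + n\<close>\<close>
    have "finite (pos ` factors x n)" using finite_factors[OF x(1)] by simp
    then obtain M where M: "\<And>v. v \<in> factors x n \<Longrightarrow> pos v < M"
      by (auto simp: finite_nat_set_iff_bounded)
    have "y \<notin> words_below q f" if y: "y \<in> infinite_words q" "prefix (M + n) y = prefix (M + n) x" for y
    proof -
      have "factors x n \<subseteq> factors y n"
      proof
        fix v assume v: "v \<in> factors x n"
        have "prefix n (suffix (pos v) y) = prefix n (suffix (pos v) x)"
          using y(2) M[OF v] unfolding prefix_eq_iff by simp
        then show "v \<in> factors y n"
          using pos[OF v] prefix_mem_factors by metis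
      qed
      then have "complexity x n \<le> complexity y n"
        unfolding complexity_def by (intro card_mono finite_factors[OF y(1)])
      then have "f n < real (complexity y n)" using n by linarith
      then show ?thesis by (auto simp: words_below_def not_le)
    qed
    then show ?thesis by auto
  qed
  then show ?thesis
    unfolding closedin_def topspace_full_shift openin_full_shift_iff
    by (auto simp: words_below_def)
qed

lemma suffix_words_below:
  assumes "w \<in> words_below q f"
  shows "suffix i w \<in> words_below q f"
proof -
  have w: "w \<in> infinite_words q" using assms by (simp add: words_below_def)
  have "real (complexity (suffix i w) n) \<le> f n" for n
  proof -
    have "complexity (suffix i w) n \<le> complexity w n"
      unfolding complexity_def by (intro card_mono finite_factors[OF w] factors_suffix_subset)
    moreover have "real (complexity w n) \<le> f n" using assms by (simp add: words_below_def)
    ultimately show ?thesis by linarith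
  qed
  then show ?thesis
    using suffix_infinite_words[OF w] by (simp add: words_below_def)
qed

theorem theorem2p3:
  fixes q :: nat and f :: "nat \<Rightarrow> real"
  assumes "q \<ge> 2" and "\<And>n. f n \<ge> 0"
  shows "((\<lambda>n. ereal (1 / real n) * elog (card (language q f n))) \<longlonglongrightarrow> word_entropy q f)
       \<and> word_entropy q f = topological_entropy (subshift q f) shift"
proof -
  interpret shift_space q "words_below q f"
    by unfold_locales (rule closedin_words_below, rule suffix_words_below)
  show ?thesis
    using growth_entropy_topological_entropy
    unfolding language_def language_eq_prefixes word_entropy_def subshift_def .
qed

end
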